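(* Let $\alpha\in\mathbb{R}$, let $u:E\times\mathbb{R}^{d-1}\to[0,\infty)$ be measurable with $u(x,\mathbf{1})>0$ for all $x\in E$, and let $h:\mathbb{R}^{d-1}\to[0,\infty)$ satisfy $h(\mathbf{1})=1$. Then $u\in T\text{-RV}^x_{\alpha}(h)$ if and only if $$u(x,\mathbf{y})=c(x)\,\exp\left\{\int_{e_0}^x \alpha(z)\,\frac{T'(z)}{T(z)}\,dz\right\}\,q(x,\mathbf{y}),\qquad x\in E,\ \mathbf{y}\in\mathbb{R}^{d-1},$$ for some measurable functions $c(\cdot)$, $\alpha(\cdot)$ on $E$ and $q$ on $E\times\mathbb{R}^{d-1}$ such that, as $t\uparrow e_1$, $c(t)\to c$ for some constant $c>0$, $\alpha(t)\to\alpha$, and $q(t,\mathbf{y})\to h(\mathbf{y})$ for every $\mathbf{y}\in\mathbb{R}^{d-1}$.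
   Context: Let $e_0\in\mathbb{R}$, $e_1\in\mathbb{R}\cup\{\infty\}$, $E=[e_0,e_1)$, and let $T:E\to[1,\infty)$ be a diffeomorphism (so $T$ is increasing and $T(e_0)=1$). For $x,y\in E$ put $x\star y:=T^{-1}\{T(x)T(y)\}$. The vector $\mathbf{1}=(1,\dots,1)\in\mathbb{R}^{d-1}$ is called the pivot. A measurable function $u:E\times\mathbb{R}^{d-1}\to[0,\infty)$ with $u(\cdot,\mathbf{1})>0$ is called regularly varying in its first component with decay $T$, index $\alpha\in\mathbb{R}$ and limit function $h$ (where $h\ge 0$, $h(\mathbf{1})=1$), written $u\in T\text{-RV}^x_\alpha(h)$, if for all $x\in E$ and $\mathbf{y}\in\mathbb{R}^{d-1}$, $$\frac{u(t\star x,\mathbf{y})}{u(t\star e_0,\mathbf{1})}\longrightarrow T(x)^\alpha h(\mathbf{y})\quad\text{as } t\uparrow e_1 .$$ *)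

theory Defs
  imports "HOL-Analysis.Analysis"
begin

definition halfopen :: "real \<Rightarrow> ereal \<Rightarrow> real set" where
  "halfopen e0 e1 = {x. e0 \<le> x \<and> ereal x < e1}"

text \<open>The filter \<open>t \<up> e1\<close>, for a finite or infinite right endpoint \<open>e1\<close> (not \<open>-\<infinity>\<close>).\<close>

definition left_limit :: "ereal \<Rightarrow> real filter" where
  "left_limit e1 = (if e1 = \<infinity> then at_top else at_left (real_of_ereal e1))"

text \<open>
  Continuous differentiability on \<open>A\<close> relative to \<open>A\<close>: at an endpoint of an interval
  belonging to \<open>A\<close> the derivative is one-sided.
\<close>

definition C1_within :: "(real \<Rightarrow> real) \<Rightarrow> real set \<Rightarrow> bool" where
  "C1_within f A \<longleftrightarrow>
     (\<exists>f'. (\<forall>x\<in>A. (f has_real_derivative f' x) (at x within A)) \<and> continuous_on A f')"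

definition diffeomorphism_onto :: "(real \<Rightarrow> real) \<Rightarrow> real set \<Rightarrow> real set \<Rightarrow> bool" where
  "diffeomorphism_onto f A B \<longleftrightarrow>
     bij_betw f A B \<and> C1_within f A \<and> C1_within (inv_into A f) B"

definition star :: "real set \<Rightarrow> (real \<Rightarrow> real) \<Rightarrow> real \<Rightarrow> real \<Rightarrow> real" where
  "star E T x y = inv_into E T (T x * T y)"

definition pivot :: "real ^ 'n" where
  "pivot = (\<chi> i. 1)"

text \<open>
  The class \<open>T-RV\<^sup>x\<^sub>\<alpha>(h)\<close> on \<open>E = [e0, e1)\<close>. Functions on \<open>E\<close> and on \<open>E \<times> \<real>\<^sup>d\<^sup>-\<^sup>1\<close> are total
  functions of which only the values for \<open>x \<in> E\<close> matter; measurability is Borel measurability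
  of the restriction, jointly in \<open>(x, y)\<close> in the second case.
\<close>

definition T_RV ::
  "real \<Rightarrow> ereal \<Rightarrow> (real \<Rightarrow> real) \<Rightarrow> real \<Rightarrow> (real ^ 'n \<Rightarrow> real) \<Rightarrow> (real \<Rightarrow> real ^ 'n \<Rightarrow> real) \<Rightarrow> bool" where
  "T_RV e0 e1 T \<alpha> h u \<longleftrightarrow>
     (let E = halfopen e0 e1 in
        (\<lambda>(x, y). u x y) \<in> borel_measurable (restrict_space borel (E \<times> UNIV)) \<and>
        (\<forall>x\<in>E. \<forall>y. 0 \<le> u x y) \<and> (\<forall>x\<in>E. 0 < u x pivot) \<and>
        (\<forall>y. 0 \<le> h y) \<and> h pivot = 1 \<and>
        (\<forall>x\<in>E. \<forall>y.
           ((\<lambda>t. u (star E T t x) y / u (star E T t e0) pivot) \<longlongrightarrow> T x powr \<alpha> * h y)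
             (left_limit e1)))"

end

theory Submission imports Defs begin

text \<open>
  In the logarithmic coordinate \<open>s = ln (T x)\<close> the operation \<open>\<star>\<close> becomes addition, and
  regular variation of \<open>f s = ln (u (x, 1))\<close> says \<open>f (s + v) - f s \<longlongrightarrow> \<alpha> v\<close> for every \<open>v \<ge> 0\<close>.
  By measurability this convergence is uniform in \<open>v \<in> [0, 1]\<close>, so \<open>f\<close> differs by \<open>o(1)\<close>
  from its linear interpolant at the integers. The slope of the interpolant tends to \<open>\<alpha>\<close>
  and serves as \<open>\<alpha>(\<cdot>)\<close>, the interpolation error gives \<open>c(\<cdot>)\<close>, and \<open>q (x, y) = u (x, y) / u (x, 1)\<close>.
  Interpolating, rather than averaging \<open>f\<close> over unit intervals as in Karamata's classical proof,
  makes local integrability of \<open>f\<close> irrelevant. Conversely, the integral from \<open>t\<close> to \<open>t \<star> x\<close>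
  has mass \<open>ln (T x)\<close> with respect to \<open>T'/T\<close>, whatever \<open>t\<close>.
\<close>

section \<open>Uniform convergence of the increments of a measurable function\<close>

lemma fmeasurable_lborel_subset_Icc:
  fixes A :: "real set"
  assumes "A \<in> sets borel" "A \<subseteq> {a..b}"
  shows "A \<in> fmeasurable lborel"
proof (rule fmeasurableI2)
  show "{a..b} \<in> fmeasurable lborel"
    by (rule fmeasurableI) (auto simp: emeasure_lborel_Icc_eq)
qed (use assms in auto)

text \<open>By pointwise convergence, the sets of those w in [0, 2] whose increments stay below
  \<epsilon> from index n on increase to [0, 2], so their measures tend to 2. Working along a
  sequence keeps the tail condition countable, hence measurable. The threshold 3/2 is chosen because
  two subsets of [0, 3] of larger measure must meet.\<close>

lemma eventually_measure_increment_small: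
  fixes k :: "real \<Rightarrow> real" and \<sigma> :: "nat \<Rightarrow> real"
  assumes [measurable]: "k \<in> borel_measurable borel"
    and lim: "\<And>w. 0 \<le> w \<Longrightarrow> ((\<lambda>s. k (s + w) - k s) \<longlongrightarrow> 0) at_top"
    and \<sigma>: "filterlim \<sigma> at_top sequentially" and "0 < \<epsilon>"
  shows "\<forall>\<^sub>F n in sequentially.
    3 / 2 < measure lborel {w \<in> {0..2}. \<bar>k (\<sigma> n + w) - k (\<sigma> n)\<bar> < \<epsilon>}"
proof -
  define U where "U n = {w \<in> {0..2}. \<forall>m\<ge>n. \<bar>k (\<sigma> m + w) - k (\<sigma> m)\<bar> < \<epsilon>}" for n
  have U_sets: "U n \<in> sets lborel" for n
    unfolding U_def by measurable
  have "w \<in> (\<Union>n. U n)" if "w \<in> {0..2}" for w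
  proof -
    have "((\<lambda>n. k (\<sigma> n + w) - k (\<sigma> n)) \<longlongrightarrow> 0) sequentially"
      using filterlim_compose[OF lim \<sigma>] that by auto
    then have "\<forall>\<^sub>F n in sequentially. \<bar>k (\<sigma> n + w) - k (\<sigma> n)\<bar> < \<epsilon>"
      using \<open>0 < \<epsilon>\<close> by (auto dest!: tendstoD simp: dist_real_def)
    then show ?thesis
      using that by (auto simp: U_def eventually_sequentially)
  qed
  then have UN: "(\<Union>n. U n) = {0..2}"
    by (auto simp: U_def)
  have "(\<lambda>n. measure lborel (U n)) \<longlonglongrightarrow> measure lborel (\<Union>n. U n)"
  proof (rule Lim_measure_incseq)
    show "incseq U"
      by (intro incseq_SucI) (auto simp: U_def)
  qed (use U_sets UN in auto)
  then have "\<forall>\<^sub>F n in sequentially. 3 / 2 < measure lborel (U n)"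
    by (rule order_tendstoD) (simp add: UN)
  then show ?thesis
  proof (rule eventually_mono)
    fix n assume "3 / 2 < measure lborel (U n)"
    also have "\<dots> \<le> measure lborel {w \<in> {0..2}. \<bar>k (\<sigma> n + w) - k (\<sigma> n)\<bar> < \<epsilon>}"
    proof (rule measure_mono_fmeasurable)
      have "{w \<in> {0..2}. \<bar>k (\<sigma> n + w) - k (\<sigma> n)\<bar> < \<epsilon>} \<in> sets lborel"
        by measurable
      then show "{w \<in> {0..2}. \<bar>k (\<sigma> n + w) - k (\<sigma> n)\<bar> < \<epsilon>} \<in> fmeasurable lborel"
        by (intro fmeasurable_lborel_subset_Icc[of _ 0 2]) auto
    qed (use U_sets in \<open>auto simp: U_def\<close>)
    finally show "3 / 2 < measure lborel {w \<in> {0..2}. \<bar>k (\<sigma> n + w) - k (\<sigma> n)\<bar> < \<epsilon>}" .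
  qed
qed

lemma measure_lborel_translation:
  fixes A :: "real set"
  assumes A: "A \<in> sets borel"
  shows "measure lborel {x. x - v \<in> A} = measure lborel A"
proof -
  have "measure lborel A = measure (distr lborel borel ((+) (- v))) A"
    by (simp add: lborel_distr_plus)
  also have "\<dots> = measure lborel ((+) (- v) -` A)"
    using A by (subst measure_distr) auto
  finally show ?thesis
    by (simp add: vimage_def)
qed

text \<open>
  If the convergence failed along \<open>\<sigma> n\<close> and \<open>v n\<close>, the increments from \<open>\<sigma> n\<close> and from \<open>\<sigma> n + v n\<close>
  would still be small on sets of measure above \<open>3/2\<close>; these, placed in \<open>[0, 3]\<close>, have to meet.
\<close>

lemma uniform_convergence_increments:
  fixes k :: "real \<Rightarrow> real"
  assumes [measurable]: "k \<in> borel_measurable borel"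
    and lim: "\<And>w. 0 \<le> w \<Longrightarrow> ((\<lambda>s. k (s + w) - k s) \<longlongrightarrow> 0) at_top"
    and "0 < \<epsilon>"
  shows "\<forall>\<^sub>F s in at_top. \<forall>v\<in>{0..1}. \<bar>k (s + v) - k s\<bar> < \<epsilon>"
proof (rule ccontr)
  assume "\<not> ?thesis"
  then have "\<forall>n. \<exists>s\<ge>real n. \<exists>v\<in>{0..1}. \<not> \<bar>k (s + v) - k s\<bar> < \<epsilon>"
    unfolding eventually_at_top_linorder by blast
  then obtain \<sigma> v where \<sigma>v: "\<And>n. real n \<le> \<sigma> n" "\<And>n. v n \<in> {0..1}"
      "\<And>n. \<not> \<bar>k (\<sigma> n + v n) - k (\<sigma> n)\<bar> < \<epsilon>"
    by metis
  have \<sigma>: "filterlim \<sigma> at_top sequentially"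
    by (rule filterlim_at_top_mono[OF filterlim_real_sequentially]) (simp add: \<sigma>v)
  have \<sigma>': "filterlim (\<lambda>n. \<sigma> n + v n) at_top sequentially"
    by (rule filterlim_at_top_mono[OF \<sigma>]) (use \<sigma>v(2) in simp)
  define A where "A n = {w \<in> {0..2}. \<bar>k (\<sigma> n + w) - k (\<sigma> n)\<bar> < \<epsilon> / 2}" for n
  define B where "B n = {w \<in> {0..2}. \<bar>k (\<sigma> n + v n + w) - k (\<sigma> n + v n)\<bar> < \<epsilon> / 2}" for n
  have "\<forall>\<^sub>F n in sequentially. 3 / 2 < measure lborel (A n) \<and> 3 / 2 < measure lborel (B n)"
    unfolding A_def B_def
    using eventually_measure_increment_small[OF _ lim \<sigma>, of "\<epsilon> / 2"]
      eventually_measure_increment_small[OF _ lim \<sigma>', of "\<epsilon> / 2"] \<open>0 < \<epsilon>\<close>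
    by (auto intro: eventually_conj)
  then obtain n where n: "3 / 2 < measure lborel (A n)" "3 / 2 < measure lborel (B n)"
    by (auto simp: eventually_sequentially)
  \<comment> \<open>The translation by \<open>v n\<close> puts both sets on the same scale: for w in
    \<open>A n\<close> and in \<open>B'\<close>, the value of k at \<open>\<sigma> n + w\<close> is
    within \<epsilon>/2 of its values at \<open>\<sigma> n\<close> and at
    \<open>\<sigma> n + v n\<close>.\<close>
  define B' where "B' = {w. w - v n \<in> B n}"
  have [measurable]: "A n \<in> sets borel" "B n \<in> sets borel"
    unfolding A_def B_def by measurable
  have B'_sets [measurable]: "B' \<in> sets borel"
    unfolding B'_def by measurable
  have B': "measure lborel B' = measure lborel (B n)"
    unfolding B'_def by (rule measure_lborel_translation) simp
  have sub: "A n \<subseteq> {0..3}" "B' \<subseteq> {0..3}"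
    using \<sigma>v(2)[of n] by (auto simp: A_def B_def B'_def)
  have fin: "A n \<in> fmeasurable lborel" "B' \<in> fmeasurable lborel"
    using sub by (auto intro: fmeasurable_lborel_subset_Icc)
  have "A n \<inter> B' \<noteq> {}"
  proof
    assume "A n \<inter> B' = {}"
    then have "measure lborel (A n \<union> B') = measure lborel (A n) + measure lborel B'"
      using fin by (intro measure_Un2[THEN trans]) (auto simp: Diff_triv Int_commute)
    moreover have "measure lborel (A n \<union> B') \<le> measure lborel {0..3::real}"
      by (rule measure_mono_fmeasurable) (use sub in \<open>auto intro: fmeasurable_lborel_subset_Icc\<close>)
    ultimately show False
      using n B' by simp
  qed
  then obtain w where w: "w \<in> A n" "w - v n \<in> B n"
    by (auto simp: B'_def)
  then have "\<bar>k (\<sigma> n + w) - k (\<sigma> n)\<bar> < \<epsilon> / 2" "\<bar>k (\<sigma> n + w) - k (\<sigma> n + v n)\<bar> < \<epsilon> / 2"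
    by (auto simp: A_def B_def)
  then show False
    using \<sigma>v(3)[of n] by linarith
qed

section \<open>Piecewise linear interpolation at the integers\<close>

definition step :: "(real \<Rightarrow> real) \<Rightarrow> real \<Rightarrow> real" where
  "step f s = f (real (nat \<lfloor>s\<rfloor>) + 1) - f (real (nat \<lfloor>s\<rfloor>))"

text \<open>The slope of this function on [n, n + 1) is \<open>step f s\<close>. For negative s,
  \<open>nat\<close> gives n = 0 and so prolongs the first segment; in the application s =
  \<open>ln (T x)\<close> is nonnegative.\<close>

definition interpolant :: "(real \<Rightarrow> real) \<Rightarrow> real \<Rightarrow> real" where
  "interpolant f s = f (real (nat \<lfloor>s\<rfloor>)) + (s - real (nat \<lfloor>s\<rfloor>)) * step f s"

lemma step_measurable [measurable]:
  "f \<in> borel_measurable borel \<Longrightarrow> step f \<in> borel_measurable borel"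
  unfolding step_def [abs_def] by measurable

lemma interpolant_measurable [measurable]:
  "f \<in> borel_measurable borel \<Longrightarrow> interpolant f \<in> borel_measurable borel"
  unfolding interpolant_def [abs_def] by measurable

lemma filterlim_real_nat_floor: "filterlim (\<lambda>s. real (nat \<lfloor>s\<rfloor>)) at_top (at_top :: real filter)"
proof (rule filterlim_at_top_mono)
  show "filterlim (\<lambda>s :: real. s - 1) at_top at_top"
    using filterlim_tendsto_add_at_top[OF tendsto_const[of "- 1 :: real"] filterlim_ident]
    by (simp add: add.commute)
  show "\<forall>\<^sub>F s :: real in at_top. s - 1 \<le> real (nat \<lfloor>s\<rfloor>)"
    by (intro always_eventually allI) linarith
qed

text \<open>The case v = 1, taken along the integer parts of s.\<close>

lemma step_tendsto:
  assumes "\<And>v. 0 \<le> v \<Longrightarrow> ((\<lambda>s. f (s + v) - f s) \<longlongrightarrow> \<alpha> * v) at_top"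
  shows "(step f \<longlongrightarrow> \<alpha>) at_top"
  unfolding step_def [abs_def]
  using filterlim_compose[OF assms[of 1] filterlim_real_nat_floor] by simp

text \<open>Subtracting \<alpha> s from f makes the increments tend to 0, hence uniformly over unit
  intervals. The error at s = n + v is the increment of f - \<alpha> s from n to n + v, minus v
  times the deviation of the slope from \<alpha>; the two terms get \<epsilon>/2 each.\<close>

lemma interpolant_error_tendsto:
  assumes meas [measurable]: "f \<in> borel_measurable borel"
    and lim: "\<And>v. 0 \<le> v \<Longrightarrow> ((\<lambda>s. f (s + v) - f s) \<longlongrightarrow> \<alpha> * v) at_top"
  shows "((\<lambda>s. f s - interpolant f s) \<longlongrightarrow> 0) at_top"
proof (rule tendstoI)
  fix \<epsilon> :: real assume "0 < \<epsilon>"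
  have "\<forall>\<^sub>F s in at_top. \<forall>v\<in>{0..1}. \<bar>(f (s + v) - \<alpha> * (s + v)) - (f s - \<alpha> * s)\<bar> < \<epsilon> / 2"
  proof (rule uniform_convergence_increments)
    fix w :: real assume "0 \<le> w"
    then show "((\<lambda>s. f (s + w) - \<alpha> * (s + w) - (f s - \<alpha> * s)) \<longlongrightarrow> 0) at_top"
      using tendsto_diff[OF lim[of w] tendsto_const[of "\<alpha> * w"]] by (simp add: algebra_simps)
  qed (use \<open>0 < \<epsilon>\<close> in auto)
  from eventually_compose_filterlim[OF this filterlim_real_nat_floor]
  have "\<forall>\<^sub>F s :: real in at_top. \<forall>v\<in>{0..1}. \<bar>(f (real (nat \<lfloor>s\<rfloor>) + v) - \<alpha> * (real (nat \<lfloor>s\<rfloor>) + v))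
      - (f (real (nat \<lfloor>s\<rfloor>)) - \<alpha> * real (nat \<lfloor>s\<rfloor>))\<bar> < \<epsilon> / 2" .
  moreover have "\<forall>\<^sub>F s in at_top. \<bar>step f s - \<alpha>\<bar> < \<epsilon> / 2"
    using tendstoD[OF step_tendsto[OF lim], of "\<epsilon> / 2"] \<open>0 < \<epsilon>\<close> by (simp add: dist_real_def)
  moreover have "\<forall>\<^sub>F s in at_top. (0 :: real) \<le> s"
    by (rule eventually_ge_at_top)
  ultimately show "\<forall>\<^sub>F s in at_top. dist (f s - interpolant f s) 0 < \<epsilon>"
  proof eventually_elim
    case (elim s)
    define n where "n = real (nat \<lfloor>s\<rfloor>)"
    define v where "v = s - n"
    have v: "v \<in> {0..1}"
      using elim(3) by (auto simp: v_def n_def) linarith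
    define X where "X = (f (n + v) - \<alpha> * (n + v)) - (f n - \<alpha> * n)"
    define Y where "Y = v * (step f s - \<alpha>)"
    have "\<bar>X\<bar> < \<epsilon> / 2"
      using elim(1) v by (auto simp: n_def X_def)
    moreover have "\<bar>Y\<bar> \<le> 1 * \<bar>step f s - \<alpha>\<bar>"
      unfolding Y_def abs_mult using v by (intro mult_right_mono) auto
    moreover have "f s - interpolant f s = X - Y"
      by (simp add: interpolant_def X_def Y_def v_def algebra_simps flip: n_def)
    moreover have "\<bar>X - Y\<bar> \<le> \<bar>X\<bar> + \<bar>Y\<bar>"
      by (rule abs_triangle_ineq4)
    ultimately have "\<bar>f s - interpolant f s\<bar> < \<epsilon> / 2 + \<epsilon> / 2"
      using elim(2) by simp
    then show ?case
      by (simp add: dist_real_def)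
  qed
qed

text \<open>A common description for finite and infinite \<open>e1\<close>, by left-closed tails
  inside E. Later arguments go through it instead of splitting on \<open>e1\<close>.\<close>

lemma eventually_left_limit:
  assumes "ereal e0 < e1"
  shows "eventually P (left_limit e1) \<longleftrightarrow>
    (\<exists>b\<in>halfopen e0 e1. \<forall>t\<in>halfopen e0 e1. b \<le> t \<longrightarrow> P t)"
proof (cases e1)
  case (real r)
  then have "e0 < r"
    using assms by simp
  show ?thesis
  proof
    assume "eventually P (left_limit e1)"
    then obtain b where b: "b < r" "\<And>t. b < t \<Longrightarrow> t < r \<Longrightarrow> P t"
      using real \<open>e0 < r\<close> by (auto simp: left_limit_def eventually_at_left)
    show "\<exists>b\<in>halfopen e0 e1. \<forall>t\<in>halfopen e0 e1. b \<le> t \<longrightarrow> P t"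
    proof (intro bexI ballI impI)
      \<comment> \<open>The midpoint lies in E and strictly above b, which turns the open tail
        supplied by \<open>at_left\<close> into a closed one.\<close>
      fix t assume "t \<in> halfopen e0 e1" "(max e0 b + r) / 2 \<le> t"
      then show "P t"
        using b \<open>e0 < r\<close> real by (intro b(2)) (auto simp: halfopen_def max_def split: if_splits)
    qed (use b \<open>e0 < r\<close> real in \<open>auto simp: halfopen_def max_def split: if_splits\<close>)
  next
    assume "\<exists>b\<in>halfopen e0 e1. \<forall>t\<in>halfopen e0 e1. b \<le> t \<longrightarrow> P t"
    then show "eventually P (left_limit e1)"
      using real \<open>e0 < r\<close>
      by (auto simp: left_limit_def halfopen_def eventually_at_left)
  qed
next
  case PInf
  have "(\<exists>N. \<forall>n\<ge>N. P n) \<longleftrightarrow> (\<exists>b\<in>{e0..}. \<forall>t\<in>{e0..}. b \<le> t \<longrightarrow> P t)"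
    by (metis atLeast_iff max.cobounded1 max.cobounded2 order_trans)
  then show ?thesis
    using PInf by (simp add: left_limit_def halfopen_def eventually_at_top_linorder atLeast_def)
qed (use assms in simp)

section \<open>The interval E and the diffeomorphism T\<close>

locale diffeo =
  fixes e0 :: real and e1 :: ereal and T :: "real \<Rightarrow> real"
  assumes e0_less: "ereal e0 < e1"
    and diffeo: "diffeomorphism_onto T (halfopen e0 e1) {1..}"
begin

abbreviation E where "E \<equiv> halfopen e0 e1"
abbreviation F where "F \<equiv> left_limit e1"
abbreviation S where "S \<equiv> inv_into E T"
abbreviation D where "D z \<equiv> vector_derivative T (at z within E)"

lemma e0_mem: "e0 \<in> E"
  using e0_less by (simp add: halfopen_def)

lemma E_ge: "x \<in> E \<Longrightarrow> e0 \<le> x"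
  by (simp add: halfopen_def)

lemma E_down: "x \<in> E \<Longrightarrow> e0 \<le> y \<Longrightarrow> y \<le> x \<Longrightarrow> y \<in> E"
  unfolding halfopen_def by (auto intro: le_less_trans[of "ereal y" "ereal x"])

lemma E_subset: "x \<in> E \<Longrightarrow> {e0..x} \<subseteq> E"
  using E_down by auto

lemma interval_E: "is_interval E"
  unfolding is_interval_1 using E_down E_ge by (meson order_trans)

lemma E_no_max:
  assumes "x \<in> E" obtains y where "x < y" "y \<in> E"
proof -
  have "ereal x < e1" "e0 \<le> x"
    using assms by (auto simp: halfopen_def)
  then obtain z where "ereal x < z" "z < e1"
    using dense by blast
  then obtain y where "z = ereal y"
    by (cases z) auto
  then show ?thesis
    using \<open>ereal x < z\<close> \<open>z < e1\<close> \<open>e0 \<le> x\<close> that[of y] by (auto simp: halfopen_def)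
qed

text \<open>A connected set with more than one point has no isolated points. This makes derivatives
  within E unique and lets limits of difference quotients inherit inequalities.\<close>

lemma at_within_E_neq_bot:
  assumes "x \<in> E" shows "at x within E \<noteq> bot"
proof -
  have "E \<noteq> {y}" for y
    using E_no_max[OF e0_mem] e0_mem by (metis less_irrefl singletonD)
  then have "x islimpt E"
    using connected_imp_perfect interval_E is_interval_connected_1 assms by blast
  then show ?thesis
    by (simp add: trivial_limit_within)
qed

lemma E_borel [measurable]: "E \<in> sets borel"
proof -
  have "E = {x \<in> space borel. e0 \<le> x \<and> ereal x < e1}"
    by (simp add: halfopen_def)
  also have "\<dots> \<in> sets borel"
    by measurable
  finally show ?thesis .
qed

lemma bij: "bij_betw T E {1..}" and S_C1: "C1_within S {1..}"
  using diffeo by (auto simp: diffeomorphism_onto_def)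

lemma T_ge: "x \<in> E \<Longrightarrow> 1 \<le> T x"
  using bij by (auto simp: bij_betw_def)

lemma S_mem: "1 \<le> r \<Longrightarrow> S r \<in> E"
  using bij_betw_inv_into[OF bij] by (auto simp: bij_betw_def)

lemma S_T [simp]: "x \<in> E \<Longrightarrow> S (T x) = x"
  using bij by (simp add: bij_betw_def)

lemma T_S [simp]: "1 \<le> r \<Longrightarrow> T (S r) = r"
  using bij by (simp add: bij_betw_inv_into_right)

text \<open>\<open>C1_within\<close> only asserts that some continuous derivative exists; uniqueness
  of derivatives within E identifies it with \<open>D\<close>, the one that occurs in the
  theorem.\<close>

lemma T_derivative:
  shows "x \<in> E \<Longrightarrow> (T has_real_derivative D x) (at x within E)"
    and D_continuous: "continuous_on E D"
proof -
  obtain T' where T': "\<And>x. x \<in> E \<Longrightarrow> (T has_real_derivative T' x) (at x within E)"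
    and cont: "continuous_on E T'"
    using diffeo unfolding diffeomorphism_onto_def C1_within_def by blast
  have D: "D x = T' x" if "x \<in> E" for x
    using T'[OF that] at_within_E_neq_bot[OF that]
    by (intro vector_derivative_within)
      (simp_all add: has_real_derivative_iff_has_vector_derivative)
  show "(T has_real_derivative D x) (at x within E)" if "x \<in> E"
    using T' D that by simp
  show "continuous_on E D"
    using cont D continuous_on_cong by force
qed

lemma T_continuous: "continuous_on E T"
  by (meson T_derivative(1) DERIV_continuous continuous_on_eq_continuous_within)

lemma S_continuous: "continuous_on {1..} S"
  using S_C1 unfolding C1_within_def
  by (meson DERIV_continuous continuous_on_eq_continuous_within)

text \<open>\<open>diffeomorphism_onto\<close> records a bijection that is C1 in both directions, so
  monotonicity has to be derived. A continuous injection on an interval is strictly monotone, and it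
  cannot decrease because the value T e0 + 1 is attained, necessarily to the right of e0.\<close>

lemma T_strict_mono: "strict_mono_on E T"
proof -
  have "strict_mono_on E T \<or> strict_antimono_on E T"
    using injective_eq_monotone_map[OF interval_E T_continuous] bij by (simp add: bij_betw_def)
  moreover have False if anti: "strict_antimono_on E T"
  proof -
    define y where "y = S (T e0 + 1)"
    have "y \<in> E" "T y = T e0 + 1"
      using T_ge[OF e0_mem] by (auto simp: y_def S_mem)
    moreover from this have "e0 < y"
      using E_ge[of y] by (cases "y = e0") auto
    ultimately show False
      using monotone_onD[OF anti e0_mem, of y] by simp
  qed
  ultimately show ?thesis
    by blast
qed

lemma T_le_iff: "x \<in> E \<Longrightarrow> y \<in> E \<Longrightarrow> T x \<le> T y \<longleftrightarrow> x \<le> y"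
  using T_strict_mono by (rule strict_mono_on_less_eq)

text \<open>The preimage of 1 lies at or to the right of e0, so monotonicity gives T e0 \<le>
  1.\<close>

lemma T_e0: "T e0 = 1"
  using T_le_iff[OF e0_mem S_mem[of 1]] E_ge[OF S_mem[of 1]] T_ge[OF e0_mem] by simp

lemma le_S_iff: "x \<in> E \<Longrightarrow> 1 \<le> r \<Longrightarrow> x \<le> S r \<longleftrightarrow> T x \<le> r"
  using T_le_iff[of x "S r"] S_mem by simp

lemma S_le_iff: "x \<in> E \<Longrightarrow> 1 \<le> r \<Longrightarrow> S r \<le> x \<longleftrightarrow> r \<le> T x"
  using T_le_iff[of "S r" x] S_mem by simp

lemma D_nonneg:
  assumes "x \<in> E" shows "0 \<le> D x"
proof -
  have "((\<lambda>y. (T y - T x) / (y - x)) \<longlongrightarrow> D x) (at x within E)"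
    using T_derivative(1)[OF assms] by (simp add: has_field_derivative_iff)
  moreover have "\<forall>\<^sub>F y in at x within E. 0 \<le> (T y - T x) / (y - x)"
    unfolding eventually_at_filter
    by (rule always_eventually) (metis T_le_iff assms diff_ge_0_iff_ge divide_nonneg_nonneg 
        divide_nonpos_nonpos linear diff_le_0_iff_le)
  ultimately show ?thesis
    by (rule tendsto_lowerbound) (rule at_within_E_neq_bot[OF assms])
qed

section \<open>The density T'/T, the derivative of \<open>ln (T z)\<close>\<close>

lemma ln_T_has_integral:
  assumes "s \<in> E" "t \<in> E" "s \<le> t"
  shows "((\<lambda>z. D z / T z) has_integral ln (T t) - ln (T s)) {s..t}"
proof (rule fundamental_theorem_of_calculus)
  fix z assume z: "z \<in> {s..t}"
  have sub: "{s..t} \<subseteq> E"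
    using assms E_down E_ge by (meson atLeastAtMost_iff order_trans subsetI)
  then have "z \<in> E" "T z > 0"
    using z T_ge[of z] by force+
  then have "((\<lambda>z. ln (T z)) has_real_derivative D z / T z) (at z within E)"
    using T_derivative(1)[of z] by (auto intro!: derivative_eq_intros)
  then show "((\<lambda>z. ln (T z)) has_vector_derivative D z / T z) (at z within {s..t})"
    using sub has_field_derivative_subset
    by (force simp flip: has_real_derivative_iff_has_vector_derivative)
qed (use assms in simp)

lemma ln_T_derivative_integrable:
  assumes "x \<in> E" shows "set_integrable lborel {e0..x} (\<lambda>z. D z / T z)"
proof (rule borel_integrable_atLeastAtMost')
  have "T z \<noteq> 0" if "z \<in> E" for z
    using T_ge[OF that] by simp
  then have "continuous_on E (\<lambda>z. D z / T z)"
    by (intro continuous_on_divide D_continuous T_continuous) auto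
  then show "continuous_on {e0..x} (\<lambda>z. D z / T z)"
    by (rule continuous_on_subset[OF _ E_subset[OF assms]])
qed

section \<open>Limits at \<open>e1\<close> and the operation \<open>star\<close>\<close>

lemma eventually_F: "eventually P F \<longleftrightarrow> (\<exists>b\<in>E. \<forall>t\<in>E. b \<le> t \<longrightarrow> P t)"
  by (rule eventually_left_limit[OF e0_less])

lemma eventually_F_E: "\<forall>\<^sub>F t in F. t \<in> E"
  using e0_mem by (auto simp: eventually_F)

text \<open>With \<open>filterlim_S_exp\<close> this transfers limits between t near
  \<open>e1\<close> and the logarithmic coordinate s near infinity, in both directions.\<close>

lemma filterlim_ln_T: "filterlim (\<lambda>t. ln (T t)) at_top F"
  unfolding filterlim_at_top
proof
  fix Z :: real
  \<comment> \<open>The maximum keeps the argument of \<open>S\<close> in [1, \<infinity>), where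
    \<open>S\<close> inverts T.\<close>
  define b where "b = S (exp (max 0 Z))"
  have "b \<in> E"
    unfolding b_def by (rule S_mem) simp
  moreover have "Z \<le> ln (T t)" if "t \<in> E" "b \<le> t" for t
  proof -
    have "exp Z \<le> exp (max 0 Z)"
      by simp
    also have "\<dots> \<le> T t"
      using that by (simp add: b_def S_le_iff)
    finally show ?thesis
      using T_ge[OF that(1)] by (simp add: ln_ge_iff)
  qed
  ultimately show "\<forall>\<^sub>F t in F. Z \<le> ln (T t)"
    unfolding eventually_F by blast
qed

lemma filterlim_S_exp: "filterlim (\<lambda>s. S (exp s)) F at_top"
  unfolding filterlim_iff
proof (intro allI impI)
  fix P assume "eventually P F"
  then obtain b where b: "b \<in> E" "\<And>t. t \<in> E \<Longrightarrow> b \<le> t \<Longrightarrow> P t"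
    by (auto simp: eventually_F)
  have "P (S (exp s))" if "ln (T b) \<le> s" for s
  proof -
    have "1 \<le> T b"
      using T_ge[OF b(1)] .
    moreover from this have "T b \<le> exp s"
      using that by (metis exp_le_cancel_iff exp_ln less_le_trans zero_less_one)
    ultimately have "1 \<le> exp s" "T b \<le> exp s"
      by linarith+
    then show ?thesis
      using b S_mem le_S_iff by blast
  qed
  then show "\<forall>\<^sub>F s in at_top. P (S (exp s))"
    unfolding eventually_at_top_linorder by blast
qed

lemma star_mem:
  assumes "t \<in> E" "x \<in> E"
  shows "star E T t x \<in> E" "T (star E T t x) = T t * T x" "t \<le> star E T t x"
proof -
  have "1 \<le> T t" "1 \<le> T x"
    using T_ge assms by auto
  then have le: "1 \<le> T t * T x" "T t \<le> T t * T x"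
    using mult_mono[of 1 "T t" 1 "T x"] by auto
  then show "star E T t x \<in> E" "T (star E T t x) = T t * T x" "t \<le> star E T t x"
    using assms by (auto simp: star_def S_mem le_S_iff)
qed

lemma star_e0: "t \<in> E \<Longrightarrow> star E T t e0 = t"
  by (simp add: star_def T_e0)

text \<open>Tails of E are stable under the map because t \<le> \<open>star E T t x\<close>.\<close>

lemma filterlim_star:
  assumes "x \<in> E" shows "filterlim (\<lambda>t. star E T t x) F F"
  unfolding filterlim_iff eventually_F
  using star_mem[OF _ assms] by (meson order_trans)

section \<open>The slope of the interpolant integrated against T'/T\<close>

lemma ln_T_measurable [measurable]:
  "(\<lambda>z. ln (T z)) \<in> borel_measurable (restrict_space borel E)"
proof (rule borel_measurable_continuous_on_restrict)
  show "continuous_on E (\<lambda>z. ln (T z))"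
    using T_ge by (intro continuous_on_ln T_continuous) force
qed

lemma set_integrable_mult_ln_T_derivative:
  assumes a: "a \<in> borel_measurable (restrict_space borel E)" and x: "x \<in> E"
    and bound: "\<And>z. z \<in> {e0..x} \<Longrightarrow> \<bar>a z\<bar> \<le> C"
  shows "set_integrable lborel {e0..x} (\<lambda>z. a z * (D z / T z))"
proof (rule set_integrable_bound)
  have int: "set_integrable lborel {e0..x} (\<lambda>z. D z / T z)"
    by (rule ln_T_derivative_integrable[OF x])
  then show "set_integrable lborel {e0..x} (\<lambda>z. C * (D z / T z))"
    by (rule set_integrable_mult_right)
  have "(\<lambda>z. indicator E z *\<^sub>R a z) \<in> borel_measurable borel"
    using a by (subst (asm) borel_measurable_restrict_space_iff) auto
  moreover have "(\<lambda>z. indicator {e0..x} z *\<^sub>R (D z / T z)) \<in> borel_measurable borel"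
    using int unfolding set_integrable_def by (auto dest: borel_measurable_integrable)
  \<comment> \<open>The function a is measurable on E only, so it enters multiplied by the indicator
    of E; that factor disappears since {e0..x} is contained in E.\<close>
  ultimately have "(\<lambda>z. (indicator E z *\<^sub>R a z) * (indicator {e0..x} z *\<^sub>R (D z / T z)))
      \<in> borel_measurable borel"
    by (rule borel_measurable_times)
  also have "(\<lambda>z. (indicator E z *\<^sub>R a z) * (indicator {e0..x} z *\<^sub>R (D z / T z))) =
      (\<lambda>z. indicator {e0..x} z *\<^sub>R (a z * (D z / T z)))"
    using E_subset[OF x] by (auto simp: indicator_def fun_eq_iff)
  finally show "set_borel_measurable lborel {e0..x} (\<lambda>z. a z * (D z / T z))"
    by (simp add: set_borel_measurable_def)
  have "\<bar>a z * (D z / T z)\<bar> \<le> \<bar>C * (D z / T z)\<bar>" if "z \<in> {e0..x}" for z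
    using bound[OF that] unfolding abs_mult by (intro mult_right_mono) auto
  then show "AE z in lborel. z \<in> {e0..x} \<longrightarrow>
      norm (a z * (D z / T z)) \<le> norm (C * (D z / T z))"
    by auto
qed

text \<open>Only finitely many slopes occur up to x, and the sum of their absolute values bounds
  them all, whatever f does between the integers.\<close>

lemma step_set_integrable:
  assumes "f \<in> borel_measurable borel" "x \<in> E"
  shows "set_integrable lborel {e0..x} (\<lambda>z. step f (ln (T z)) * (D z / T z))"
proof (rule set_integrable_mult_ln_T_derivative)
  show "(\<lambda>z. step f (ln (T z))) \<in> borel_measurable (restrict_space borel E)"
    using measurable_compose[OF ln_T_measurable step_measurable[OF assms(1)]] .
next
  fix z assume z: "z \<in> {e0..x}"
  then have "z \<in> E"
    using E_subset[OF assms(2)] by auto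
  then have "ln (T z) \<le> ln (T x)"
    using z T_le_iff[of z x] T_ge[of z] T_ge[of x] assms(2) by simp
  then have "nat \<lfloor>ln (T z)\<rfloor> \<le> nat \<lfloor>ln (T x)\<rfloor>"
    by (intro nat_mono floor_mono)
  then show "\<bar>step f (ln (T z))\<bar> \<le> (\<Sum>n\<le>nat \<lfloor>ln (T x)\<rfloor>. \<bar>f (real n + 1) - f (real n)\<bar>)"
    unfolding step_def
    by (intro member_le_sum[of _ _ "\<lambda>n. \<bar>f (real n + 1) - f (real n)\<bar>"]) auto
qed (use assms in simp)

text \<open>Between s and t the logarithmic coordinate stays in one unit cell, so the slope is
  constant except possibly at t, where \<open>ln (T t)\<close> may already equal n + 1. That single
  point is removed as a spike.\<close>

lemma step_has_integral_piece:
  assumes "s \<in> E" "t \<in> E" "s \<le> t" and n: "real n \<le> ln (T s)" "ln (T t) \<le> real n + 1"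
  shows "((\<lambda>z. step f (ln (T z)) * (D z / T z)) has_integral
    (f (real n + 1) - f (real n)) * (ln (T t) - ln (T s))) {s..t}"
proof (rule has_integral_spike_finite)
  show "((\<lambda>z. (f (real n + 1) - f (real n)) * (D z / T z)) has_integral
    (f (real n + 1) - f (real n)) * (ln (T t) - ln (T s))) {s..t}"
    by (intro has_integral_mult_right ln_T_has_integral assms)
  fix z assume z: "z \<in> {s..t} - {t}"
  then have "z \<in> E"
    using assms E_down[of t z] E_ge[of s] by auto
  then have "1 \<le> T s" "T s \<le> T z" "T z < T t"
    using z assms T_le_iff[of s z] T_le_iff[of t z] T_ge[of s] by auto
  then have "ln (T s) \<le> ln (T z)" "ln (T z) < ln (T t)"
    by simp_all
  then have "\<lfloor>ln (T z)\<rfloor> = int n"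
    using n by linarith
  then show "step f (ln (T z)) * (D z / T z) = (f (real n + 1) - f (real n)) * (D z / T z)"
    by (simp add: step_def)
qed simp

text \<open>The points \<open>b n\<close> have logarithmic coordinate n. Over the full cells the
  integral telescopes to f n - f 0, and the last partial cell, from \<open>b n\<close> to x, adds
  the linear part of the interpolant.\<close>

lemma step_has_integral:
  assumes "x \<in> E"
  shows "((\<lambda>z. step f (ln (T z)) * (D z / T z)) has_integral
    interpolant f (ln (T x)) - f 0) {e0..x}"
proof -
  define b where "b n = S (exp (real n))" for n
  have bE: "b n \<in> E" and Tb: "T (b n) = exp (real n)" for n
    by (simp_all add: b_def S_mem)
  have b_mono: "b n \<le> b (Suc n)" for n
    using T_le_iff[OF bE[of n] bE[of "Suc n"]] by (simp add: Tb)
  have b0: "b 0 = e0"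
    using S_T[OF e0_mem] by (simp add: b_def T_e0)
  have ints: "((\<lambda>z. step f (ln (T z)) * (D z / T z)) has_integral f (real n) - f 0) {e0..b n}" for n
  proof (induction n)
    case 0
    then show ?case
      by (simp add: b0 has_integral_refl)
  next
    case (Suc n)
    have "((\<lambda>z. step f (ln (T z)) * (D z / T z)) has_integral
        (f (real n + 1) - f (real n)) * (ln (T (b (Suc n))) - ln (T (b n)))) {b n..b (Suc n)}"
      by (intro step_has_integral_piece bE b_mono) (simp_all add: Tb)
    from has_integral_combine[OF E_ge[OF bE] b_mono Suc this] show ?case
      by (simp add: Tb add.commute)
  qed
  define n where "n = nat \<lfloor>ln (T x)\<rfloor>"
  have n: "real n \<le> ln (T x)" "ln (T x) \<le> real n + 1"
    using T_ge[OF assms] by (auto simp: n_def)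
  then have "exp (real n) \<le> T x"
    using T_ge[OF assms] by (simp add: ln_ge_iff)
  then have "b n \<le> x"
    using S_le_iff[OF assms] by (simp add: b_def)
  moreover from this have "((\<lambda>z. step f (ln (T z)) * (D z / T z)) has_integral
      (f (real n + 1) - f (real n)) * (ln (T x) - ln (T (b n)))) {b n..x}"
    using n by (intro step_has_integral_piece bE assms) (simp_all add: Tb)
  ultimately have "((\<lambda>z. step f (ln (T z)) * (D z / T z)) has_integral
      (f (real n) - f 0) + (f (real n + 1) - f (real n)) * (ln (T x) - ln (T (b n)))) {e0..x}"
    using has_integral_combine[OF E_ge[OF bE] _ ints] by blast
  then show ?thesis
    by (simp add: interpolant_def step_def Tb n_def algebra_simps)
qed

text \<open>The value comes from the gauge integral; integrability identifies it with the Lebesgue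
  integral.\<close>

lemma step_set_integral:
  assumes "f \<in> borel_measurable borel" "x \<in> E"
  shows "(LINT z:{e0..x}|lborel. step f (ln (T z)) * (D z / T z)) = interpolant f (ln (T x)) - f 0"
  using set_borel_integral_eq_integral(2)[OF step_set_integrable[OF assms]]
    integral_unique[OF step_has_integral[OF assms(2)]] by simp

text \<open>The difference from the limit is the integral of (a - \<alpha>) T'/T from t to
  \<open>star E T t x\<close>. The mass of T'/T there is \<open>ln (T x)\<close> for every t, so a
  uniform bound \<delta> on |a - \<alpha>| beyond b bounds it by \<delta>
  \<open>ln (T x)\<close>.\<close>

lemma set_integral_star_tendsto:
  assumes a: "(a \<longlongrightarrow> \<alpha>) F" and x: "x \<in> E"
    and int: "\<And>x. x \<in> E \<Longrightarrow> set_integrable lborel {e0..x} (\<lambda>z. a z * (D z / T z))"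
  defines "P \<equiv> \<lambda>x. LINT z:{e0..x}|lborel. a z * (D z / T z)"
  shows "((\<lambda>t. P (star E T t x) - P t) \<longlongrightarrow> \<alpha> * ln (T x)) F"
proof (rule tendstoI)
  fix \<epsilon> :: real assume "0 < \<epsilon>"
  have L: "0 \<le> ln (T x)"
    using T_ge[OF x] by simp
  \<comment> \<open>Adding 1 covers x = e0, where the logarithm vanishes, and makes the final
    estimate strict.\<close>
  define \<delta> where "\<delta> = \<epsilon> / (ln (T x) + 1)"
  have "0 < \<delta>"
    using L \<open>0 < \<epsilon>\<close> by (simp add: \<delta>_def)
  then obtain b where b: "b \<in> E" "\<And>t. t \<in> E \<Longrightarrow> b \<le> t \<Longrightarrow> \<bar>a t - \<alpha>\<bar> < \<delta>"
    using tendstoD[OF a, of \<delta>] by (auto simp: eventually_F dist_real_def)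
  have "dist (P (star E T t x) - P t) (\<alpha> * ln (T x)) < \<epsilon>" if t: "t \<in> E" "b \<le> t" for t
  proof -
    define t' where "t' = star E T t x"
    have t': "t' \<in> E" "T t' = T t * T x" "t \<le> t'"
      using star_mem[OF t(1) x] by (simp_all add: t'_def)
    have sub: "z \<in> E" "b \<le> z" if "z \<in> {t..t'}" for z
      using that E_down[OF t'(1), of z] E_ge[OF t(1)] t by auto
    have "ln (T t') = ln (T t) + ln (T x)"
      using T_ge[OF t(1)] T_ge[OF x] by (simp add: t' ln_mult)
    then have lnT: "((\<lambda>z. c * (D z / T z)) has_integral c * ln (T x)) {t..t'}" for c
      using has_integral_mult_right[OF ln_T_has_integral[OF t(1) t'(1,3)], of c] by simp
    have P: "P y = integral {e0..y} (\<lambda>z. a z * (D z / T z))"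
      "(\<lambda>z. a z * (D z / T z)) integrable_on {e0..y}" if "y \<in> E" for y
      unfolding P_def using set_borel_integral_eq_integral[OF int[OF that]] by auto
    have "(\<lambda>z. a z * (D z / T z)) integrable_on {t..t'}"
      by (rule integrable_on_subinterval[OF P(2)[OF t'(1)]]) (use E_ge[OF t(1)] in auto)
    moreover have "P t' - P t = integral {t..t'} (\<lambda>z. a z * (D z / T z))"
      using Henstock_Kurzweil_Integration.integral_combine[OF E_ge[OF t(1)] t'(3) P(2)[OF t'(1)]]
        P(1)[OF t(1)] P(1)[OF t'(1)] by simp
    ultimately have "((\<lambda>z. a z * (D z / T z) - \<alpha> * (D z / T z)) has_integral
        (P t' - P t) - \<alpha> * ln (T x)) {t..t'}"
      using has_integral_diff[OF _ lnT] by (simp add: has_integral_integral)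
    then have diff: "(\<lambda>z. a z * (D z / T z) - \<alpha> * (D z / T z)) integrable_on {t..t'}"
      "integral {t..t'} (\<lambda>z. a z * (D z / T z) - \<alpha> * (D z / T z)) = (P t' - P t) - \<alpha> * ln (T x)"
      by (auto dest: integral_unique)
    have "\<bar>integral {t..t'} (\<lambda>z. a z * (D z / T z) - \<alpha> * (D z / T z))\<bar> \<le>
        integral {t..t'} (\<lambda>z. \<delta> * (D z / T z))"
      unfolding real_norm_def [symmetric]
    proof (rule Henstock_Kurzweil_Integration.integral_norm_bound_integral[OF diff(1)])
      show "(\<lambda>z. \<delta> * (D z / T z)) integrable_on {t..t'}"
        using lnT by (rule has_integral_integrable)
      fix z assume "z \<in> {t..t'}"
      note z = sub[OF this]
      have "\<bar>a z * (D z / T z) - \<alpha> * (D z / T z)\<bar> = \<bar>a z - \<alpha>\<bar> * (D z / T z)"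
        using D_nonneg[OF z(1)] T_ge[OF z(1)]
        by (simp only: abs_mult flip: left_diff_distrib) simp
      also have "\<dots> \<le> \<delta> * (D z / T z)"
        using b(2)[OF z] D_nonneg[OF z(1)] T_ge[OF z(1)] by (intro mult_right_mono) auto
      finally show "norm (a z * (D z / T z) - \<alpha> * (D z / T z)) \<le> \<delta> * (D z / T z)"
        by simp
    qed
    also have "\<dots> = \<delta> * ln (T x)"
      using lnT by (rule integral_unique)
    also have "\<delta> * ln (T x) < \<epsilon>"
      using L \<open>0 < \<epsilon>\<close> by (simp add: \<delta>_def field_simps)
    finally show ?thesis
      by (simp only: diff(2) dist_real_def flip: t'_def)
  qed
  then show "\<forall>\<^sub>F t in F. dist (P (star E T t x) - P t) (\<alpha> * ln (T x)) < \<epsilon>"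
    using b(1) unfolding eventually_F by blast
qed

section \<open>Measurability of sections and of the change of variable\<close>

lemma section_measurable:
  fixes u :: "real \<Rightarrow> 'a :: euclidean_space \<Rightarrow> real"
  assumes "(\<lambda>(x, y). u x y) \<in> borel_measurable (restrict_space borel (E \<times> UNIV))"
  shows "(\<lambda>x. u x y) \<in> borel_measurable (restrict_space borel E)"
proof -
  have "(\<lambda>x. (x, y)) \<in> measurable borel borel"
    by (intro borel_measurable_continuous_onI continuous_intros)
  then have "(\<lambda>x. (x, y)) \<in> measurable (restrict_space borel E) (restrict_space borel (E \<times> UNIV))"
    by (intro measurable_restrict_space2 measurable_restrict_space1) (auto simp: space_restrict_space)
  from measurable_compose[OF this assms] show ?thesis
    by simp
qed

lemma fst_measurable_E:
  "fst \<in> measurable (restrict_space borel (E \<times> (UNIV :: 'a :: euclidean_space set))) (restrict_space borel E)"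
proof -
  have "(fst :: real \<times> 'a \<Rightarrow> real) \<in> borel_measurable borel"
    by (intro borel_measurable_continuous_onI continuous_intros)
  then show ?thesis
    by (intro measurable_restrict_space2 measurable_restrict_space1) (auto simp: space_restrict_space)
qed

text \<open>Truncating at 0 yields a map that is continuous on the whole line with values in E, so u
  (., 1) composed with it is Borel on all of \<real>.\<close>

lemma S_exp_measurable:
  "(\<lambda>s. S (exp (max 0 s))) \<in> measurable borel (restrict_space borel E)"
proof (rule measurable_restrict_space2)
  have "continuous_on UNIV (\<lambda>s. S (exp (max 0 s)))"
    by (rule continuous_on_compose2[OF S_continuous]) (auto intro!: continuous_intros)
  then show "(\<lambda>s. S (exp (max 0 s))) \<in> borel_measurable borel"
    by (rule borel_measurable_continuous_onI)
qed (auto simp: S_mem)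

section \<open>Regular variation and the exponential representation\<close>

lemma T_RV_imp_increments_tendsto:
  fixes u :: "real \<Rightarrow> real ^ 'n \<Rightarrow> real"
  assumes RV: "T_RV e0 e1 T \<alpha> h u" and "0 \<le> v"
  defines "f \<equiv> \<lambda>s. ln (u (S (exp (max 0 s))) pivot)"
  shows "((\<lambda>s. f (s + v) - f s) \<longlongrightarrow> \<alpha> * v) at_top"
proof -
  have pos: "0 < u (S (exp s)) pivot" if "0 \<le> s" for s
    using RV that by (simp add: T_RV_def Let_def S_mem)
  have x: "S (exp v) \<in> E"
    using \<open>0 \<le> v\<close> by (simp add: S_mem)
  \<comment> \<open>Regular variation at the pivot with x = \<open>S (exp v)\<close>: the limit T x
    powr \<alpha> becomes exp (\<alpha> v), and its logarithm is the required \<alpha> v.\<close>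
  have "((\<lambda>t. u (star E T t (S (exp v))) pivot / u (star E T t e0) pivot) \<longlongrightarrow>
      T (S (exp v)) powr \<alpha> * h pivot) F"
    using RV x unfolding T_RV_def Let_def by blast
  then have "((\<lambda>t. u (star E T t (S (exp v))) pivot / u (star E T t e0) pivot) \<longlongrightarrow>
      exp (\<alpha> * v)) F"
    using RV \<open>0 \<le> v\<close> by (simp add: T_RV_def Let_def powr_def)
  from tendsto_ln[OF filterlim_compose[OF this filterlim_S_exp]]
  have "((\<lambda>s. ln (u (star E T (S (exp s)) (S (exp v))) pivot / u (star E T (S (exp s)) e0) pivot))
      \<longlongrightarrow> \<alpha> * v) at_top"
    by simp
  then show ?thesis
  proof (rule Lim_transform_eventually)
    show "\<forall>\<^sub>F s in at_top. ln (u (star E T (S (exp s)) (S (exp v))) pivot /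
        u (star E T (S (exp s)) e0) pivot) = f (s + v) - f s"
      using eventually_ge_at_top[of 0]
    proof eventually_elim
      case (elim s)
      then have "star E T (S (exp s)) (S (exp v)) = S (exp (s + v))"
        using \<open>0 \<le> v\<close> by (simp add: star_def exp_add)
      moreover have "star E T (S (exp s)) e0 = S (exp s)"
        using elim by (intro star_e0 S_mem) simp
      moreover have "0 < u (S (exp (s + v))) pivot" "0 < u (S (exp s)) pivot"
        using elim \<open>0 \<le> v\<close> by (auto intro: pos)
      ultimately show ?case
        using elim \<open>0 \<le> v\<close> by (simp add: f_def ln_div max_def)
    qed
  qed
qed

lemma T_RV_imp_representation:
  fixes u :: "real \<Rightarrow> real ^ 'n \<Rightarrow> real"
  assumes RV: "T_RV e0 e1 T \<alpha> h u"
  shows "\<exists>c a q.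
    c \<in> borel_measurable (restrict_space borel E) \<and>
    a \<in> borel_measurable (restrict_space borel E) \<and>
    (\<lambda>(x, y). q x y) \<in> borel_measurable (restrict_space borel (E \<times> UNIV)) \<and>
    (\<exists>c\<^sub>0>0. (c \<longlongrightarrow> c\<^sub>0) F) \<and> (a \<longlongrightarrow> \<alpha>) F \<and> (\<forall>y. ((\<lambda>t. q t y) \<longlongrightarrow> h y) F) \<and>
    (\<forall>x\<in>E. set_integrable lborel {e0..x} (\<lambda>z. a z * (D z / T z))) \<and>
    (\<forall>x\<in>E. \<forall>y. u x y = c x * exp (LINT z:{e0..x}|lborel. a z * (D z / T z)) * q x y)"
proof -
  have meas: "(\<lambda>(x, y). u x y) \<in> borel_measurable (restrict_space borel (E \<times> UNIV))"
    and pos: "\<And>x. x \<in> E \<Longrightarrow> 0 < u x pivot"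
    and lim: "\<And>x y. x \<in> E \<Longrightarrow>
      ((\<lambda>t. u (star E T t x) y / u (star E T t e0) pivot) \<longlongrightarrow> T x powr \<alpha> * h y) F"
    using RV by (auto simp: T_RV_def Let_def)
  have meas_pivot [measurable]: "(\<lambda>x. u x pivot) \<in> borel_measurable (restrict_space borel E)"
    by (rule section_measurable[OF meas])
  define f where "f s = ln (u (S (exp (max 0 s))) pivot)" for s
  have f_meas [measurable]: "f \<in> borel_measurable borel"
    using measurable_compose[OF S_exp_measurable meas_pivot] by (simp add: f_def [abs_def])
  have f_lim: "((\<lambda>s. f (s + v) - f s) \<longlongrightarrow> \<alpha> * v) at_top" if "0 \<le> v" for v
    unfolding f_def using T_RV_imp_increments_tendsto[OF RV that] .
  have u_eq: "u x pivot = exp (f (ln (T x)))" if "x \<in> E" for x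
    using T_ge[OF that] that pos by (simp add: f_def max_def)
  define a where "a z = step f (ln (T z))" for z
  \<comment> \<open>The value of the integral in the exponent. The term f 0 is subtracted because
    the integral starts at e0, where the logarithmic coordinate is 0; hence c tends to exp (f 0),
    which is u (e0, 1), and not to 1.\<close>
  define I where "I x = interpolant f (ln (T x)) - f 0" for x
  define c where "c x = u x pivot / exp (I x)" for x
  define q where "q x y = u x y / u x pivot" for x y
  have a_eq: "(\<lambda>z. a z * (D z / T z)) = (\<lambda>z. step f (ln (T z)) * (D z / T z))"
    by (simp add: a_def)
  have "(\<lambda>x. interpolant f (ln (T x))) \<in> borel_measurable (restrict_space borel E)"
    using measurable_compose[OF ln_T_measurable interpolant_measurable[OF f_meas]] .
  then have "c \<in> borel_measurable (restrict_space borel E)"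
    unfolding c_def [abs_def] I_def by measurable
  have "a \<in> borel_measurable (restrict_space borel E)"
    using measurable_compose[OF ln_T_measurable step_measurable[OF f_meas]] by (simp add: a_def [abs_def])
  have "(\<lambda>(x, y). q x y) \<in> borel_measurable (restrict_space borel (E \<times> UNIV))"
    using borel_measurable_divide[OF meas measurable_compose[OF fst_measurable_E meas_pivot]]
    by (simp add: q_def case_prod_unfold)
  have "(c \<longlongrightarrow> exp (f 0)) F"
  proof (rule Lim_transform_eventually)
    have "((\<lambda>t. f (ln (T t)) - interpolant f (ln (T t))) \<longlongrightarrow> 0) F"
      using filterlim_compose[OF interpolant_error_tendsto[OF f_meas f_lim] filterlim_ln_T] .
    then have "((\<lambda>t. f (ln (T t)) - interpolant f (ln (T t)) + f 0) \<longlongrightarrow> 0 + f 0) F"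
      by (intro tendsto_intros)
    then show "((\<lambda>t. exp (f (ln (T t)) - interpolant f (ln (T t)) + f 0)) \<longlongrightarrow> exp (f 0)) F"
      by (auto intro!: tendsto_exp)
    show "\<forall>\<^sub>F t in F. exp (f (ln (T t)) - interpolant f (ln (T t)) + f 0) = c t"
      using eventually_F_E
      by eventually_elim (simp add: c_def I_def u_eq exp_diff exp_add)
  qed
  have "(a \<longlongrightarrow> \<alpha>) F"
    unfolding a_def [abs_def] using filterlim_compose[OF step_tendsto[OF f_lim] filterlim_ln_T] .
  \<comment> \<open>This is regular variation at x = e0, where T x = 1 and \<open>star\<close>
    leaves t fixed.\<close>
  have "((\<lambda>t. q t y) \<longlongrightarrow> h y) F" for y
  proof (rule Lim_transform_eventually)
    show "((\<lambda>t. u (star E T t e0) y / u (star E T t e0) pivot) \<longlongrightarrow> h y) F"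
      using lim[OF e0_mem, of y] by (simp add: T_e0)
    show "\<forall>\<^sub>F t in F. u (star E T t e0) y / u (star E T t e0) pivot = q t y"
      using eventually_F_E by eventually_elim (simp add: q_def star_e0)
  qed
  have "set_integrable lborel {e0..x} (\<lambda>z. a z * (D z / T z))" if "x \<in> E" for x
    unfolding a_eq by (rule step_set_integrable[OF f_meas that])
  have "u x y = c x * exp (LINT z:{e0..x}|lborel. a z * (D z / T z)) * q x y"
    if "x \<in> E" for x y
  proof -
    have "(LINT z:{e0..x}|lborel. a z * (D z / T z)) = I x"
      unfolding a_eq I_def by (rule step_set_integral[OF f_meas that])
    then show ?thesis
      using pos[OF that] by (simp add: c_def q_def)
  qed
  show ?thesis
    by (intro exI[of _ c] exI[of _ a] exI[of _ q] conjI allI ballI exI[of _ "exp (f 0)"] exp_gt_zero)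
      fact+
qed

text \<open>The ratio splits into three: the quotient of the c tends to 1 as their limit is
  positive, the exponential of the integral from t to \<open>star E T t x\<close> gives the power of
  T x, and the quotient of the q tends to h y / h pivot = h y.\<close>

lemma representation_imp_ratio_tendsto:
  fixes u :: "real \<Rightarrow> real ^ 'n \<Rightarrow> real"
  assumes c: "(c \<longlongrightarrow> c\<^sub>0) F" "0 < c\<^sub>0" and a: "(a \<longlongrightarrow> \<alpha>) F"
    and q: "\<forall>y. ((\<lambda>t. q t y) \<longlongrightarrow> h y) F" and h: "h pivot = 1"
    and int: "\<forall>x\<in>E. set_integrable lborel {e0..x} (\<lambda>z. a z * (D z / T z))"
    and u: "\<forall>x\<in>E. \<forall>y. u x y =
       c x * exp (LINT z:{e0..x}|lborel. a z * (D z / T z)) * q x y"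
    and x: "x \<in> E"
  shows "((\<lambda>t. u (star E T t x) y / u (star E T t e0) pivot) \<longlongrightarrow> T x powr \<alpha> * h y) F"
proof -
  define P where "P x = (LINT z:{e0..x}|lborel. a z * (D z / T z))" for x
  note star = filterlim_compose[OF _ filterlim_star[OF x]]
  have "((\<lambda>t. c (star E T t x) / c t * exp (P (star E T t x) - P t) * (q (star E T t x) y / q t pivot))
      \<longlongrightarrow> c\<^sub>0 / c\<^sub>0 * exp (\<alpha> * ln (T x)) * (h y / h pivot)) F"
  proof (intro tendsto_mult tendsto_divide tendsto_exp)
    show "((\<lambda>t. P (star E T t x) - P t) \<longlongrightarrow> \<alpha> * ln (T x)) F"
      unfolding P_def by (rule set_integral_star_tendsto[OF a x int[rule_format]])
    show "((\<lambda>t. c (star E T t x)) \<longlongrightarrow> c\<^sub>0) F"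
      by (rule star[OF c(1)])
    show "((\<lambda>t. q (star E T t x) y) \<longlongrightarrow> h y) F"
      by (rule star[OF q[THEN spec]])
    show "((\<lambda>t. q t pivot) \<longlongrightarrow> h pivot) F"
      by (rule q[THEN spec])
  qed (use c h in simp_all)
  then have "((\<lambda>t. c (star E T t x) / c t * exp (P (star E T t x) - P t) * (q (star E T t x) y / q t pivot))
      \<longlongrightarrow> T x powr \<alpha> * h y) F"
    using c(2) h T_ge[OF x] by (simp add: powr_def)
  then show ?thesis
  proof (rule Lim_transform_eventually)
    show "\<forall>\<^sub>F t in F. c (star E T t x) / c t * exp (P (star E T t x) - P t) *
        (q (star E T t x) y / q t pivot) = u (star E T t x) y / u (star E T t e0) pivot"
      using eventually_F_E
    proof eventually_elim
      case (elim t)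
      have u_eq: "u s z = c s * exp (P s) * q s z" if "s \<in> E" for s z
        using u that by (simp add: P_def)
      show ?case
        \<comment> \<open>The factorization also holds where \<open>c t\<close> or
          \<open>q t pivot\<close> vanishes, since division by zero yields zero.\<close>
        unfolding star_e0[OF elim] u_eq[OF elim] u_eq[OF star_mem(1)[OF elim x]] exp_diff
        by simp
    qed
  qed
qed

end

text \<open>The integrability clause gives the exponent its intended meaning: the Lebesgue integral
  of a nonintegrable function has the default value 0.\<close>

theorem theorem0p2:
  fixes e0 :: real and e1 :: ereal and T :: "real \<Rightarrow> real" and \<alpha> :: real
    and u :: "real \<Rightarrow> real ^ 'n \<Rightarrow> real" and h :: "real ^ 'n \<Rightarrow> real"
  defines "E \<equiv> halfopen e0 e1"
  assumes "ereal e0 < e1"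
    and "diffeomorphism_onto T E {1..}"
    and "(\<lambda>(x, y). u x y) \<in> borel_measurable (restrict_space borel (E \<times> UNIV))"
    and "\<And>x y. x \<in> E \<Longrightarrow> 0 \<le> u x y"
    and "\<And>x. x \<in> E \<Longrightarrow> 0 < u x pivot"
    and "\<And>y. 0 \<le> h y"
    and "h pivot = 1"
  shows "T_RV e0 e1 T \<alpha> h u \<longleftrightarrow>
    (\<exists>(c :: real \<Rightarrow> real) (a :: real \<Rightarrow> real) (q :: real \<Rightarrow> real ^ 'n \<Rightarrow> real).
       c \<in> borel_measurable (restrict_space borel E) \<and>
       a \<in> borel_measurable (restrict_space borel E) \<and>
       (\<lambda>(x, y). q x y) \<in> borel_measurable (restrict_space borel (E \<times> UNIV)) \<and>
       (\<exists>c\<^sub>0>0. (c \<longlongrightarrow> c\<^sub>0) (left_limit e1)) \<and>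
       (a \<longlongrightarrow> \<alpha>) (left_limit e1) \<and>
       (\<forall>y. ((\<lambda>t. q t y) \<longlongrightarrow> h y) (left_limit e1)) \<and>
       (\<forall>x\<in>E. set_integrable lborel {e0..x}
                 (\<lambda>z. a z * (vector_derivative T (at z within E) / T z))) \<and>
       (\<forall>x\<in>E. \<forall>y. u x y =
          c x * exp (LINT z:{e0..x}|lborel. a z * (vector_derivative T (at z within E) / T z)) * q x y))"
    (is "_ \<longleftrightarrow> ?representation")
proof -
  interpret RV: diffeo e0 e1 T
    using assms(2,3) by unfold_locales (simp_all add: E_def)
  show ?thesis
  proof
    assume "T_RV e0 e1 T \<alpha> h u"
    then show ?representation
      unfolding E_def by (rule RV.T_RV_imp_representation)
  next
    assume ?representation
    then show "T_RV e0 e1 T \<alpha> h u"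
    proof (elim exE conjE)
      fix c a :: "real \<Rightarrow> real" and q :: "real \<Rightarrow> real ^ 'n \<Rightarrow> real" and c\<^sub>0 :: real
      assume "0 < c\<^sub>0" "(c \<longlongrightarrow> c\<^sub>0) (left_limit e1)" "(a \<longlongrightarrow> \<alpha>) (left_limit e1)"
        "\<forall>y. ((\<lambda>t. q t y) \<longlongrightarrow> h y) (left_limit e1)"
        "\<forall>x\<in>E. set_integrable lborel {e0..x}
          (\<lambda>z. a z * (vector_derivative T (at z within E) / T z))"
        "\<forall>x\<in>E. \<forall>y. u x y =
          c x * exp (LINT z:{e0..x}|lborel. a z * (vector_derivative T (at z within E) / T z)) * q x y"
      note ratio = RV.representation_imp_ratio_tendsto
        [OF this(2,1,3,4) assms(8) this(5,6)[unfolded E_def], folded E_def]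
      show ?thesis
        unfolding T_RV_def Let_def E_def [symmetric]
        by (intro conjI ballI allI assms(4-8) ratio)
    qed
  qed
qed

end
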